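(* Let $(\Omega,\mathcal{A},\nu)$ be a measure space with $\nu:\mathcal{A}\to\mathbb{R}^+_0$ countably additive, and let $X$ be a Banach space. Let $\phi:\Omega\to\mathbb{R}$ be a measurable function and let $\Phi:\Omega\to X$ be a strongly measurable function with $\Phi\in Bi_1(\Omega,\nu)$. Put $N(A)=(Bi_1)\int_A\Phi\,d\nu$ for $A\in\mathcal{A}$. Then $$\phi(\cdot)\Phi(\cdot)\in Bi_1(\Omega,\nu)\iff\phi(\cdot)\in Bi_2(\Omega,N),$$ and $$(Bi_1)\int_\Omega\phi(\omega)\Phi(\omega)\,d\nu=(Bi_2)\int_\Omega\phi(\omega)\,dN.$$
   Context: A partition of $\Omega$ is a finite or countable family of non-empty, pairwise disjoint measurable sets covering $\Omega$; $P$ is finer than $P'$ if every $U\in P$ is contained in some $U'\in P'$. First type Birkhoff integral: for a scalar countably additive measure $\nu:\mathcal{A}\to\mathbb{R}^+_0$, $\Phi:\Omega\to X$ is in $Bi_1(\Omega,\nu)$ if there is $\mathcal{I}\in X$ such that for all $\varepsilon>0$ there is a partition $P_\varepsilon$ of $\Omega$ such that for every countable partition $(U_n)_n$ of $\Omega$ finer than $P_\varepsilon$ and all $\omega_n\in U_n$, $\limsup_n\|\sum_{k=1}^n\Phi(\omega_k)\nu(U_k)-\mathcal{I}\|<\varepsilon$ (finite partitions are allowed, the sums then being finite); $\mathcal{I}=(Bi_1)\int_\Omega\Phi\,d\nu$. Second type Birkhoff integral: for a countably additive measure $N:\mathcal{A}\to X$, $\phi:\Omega\to\mathbb{R}$ is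 in $Bi_2(\Omega,N)$ if there is $\mathcal{I}\in X$ such that for all $\varepsilon>0$ there is a partition $P_\varepsilon$ of $\Omega$ such that for every countable partition $(U_n)_n$ finer than $P_\varepsilon$ and all $\omega_n\in U_n$, $\limsup_n\|\sum_{k=1}^n\phi(\omega_k)N(U_k)-\mathcal{I}\|<\varepsilon$; $\mathcal{I}=(Bi_2)\int_\Omega\phi\,dN$. Integrals over $A\in\mathcal{A}$ are defined by restricting to $A$. If $\Phi\in Bi_1(\Omega,\nu)$, it is integrable on every $A\in\mathcal{A}$ and $A\mapsto(Bi_1)\int_A\Phi\,d\nu$ is countably additive. *)

theory Defs
  imports "HOL-Analysis.Analysis"
begin

text \<open>Almost everywhere limit of simple functions. (Borel measurability is not the same thing in a
  non-separable Banach space.)\<close>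

definition strongly_measurable :: "'a measure \<Rightarrow> ('a \<Rightarrow> 'b::banach) \<Rightarrow> bool" where
  "strongly_measurable M f \<longleftrightarrow>
     (\<exists>s. (\<forall>n. simple_function M (s n)) \<and> (AE x in M. (\<lambda>n. s n x) \<longlonglongrightarrow> f x))"

definition measurable_partition :: "'a measure \<Rightarrow> 'a set \<Rightarrow> 'a set set \<Rightarrow> bool" where
  "measurable_partition M A P \<longleftrightarrow> partition_on A P \<and> countable P \<and> P \<subseteq> sets M"

text \<open>A partition listed in a fixed order without repetition. The index set \<open>I\<close> is all of the natural
  numbers for an infinite partition and an initial segment \<open>{..<m}\<close> for a finite one; since the members
  are non-empty, a finite partition cannot be padded with empty sets.\<close>

definition partition_enumeration :: "'a measure \<Rightarrow> 'a set \<Rightarrow> nat set \<Rightarrow> (nat \<Rightarrow> 'a set) \<Rightarrow> bool" where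
  "partition_enumeration M A I U \<longleftrightarrow>
     (I = UNIV \<or> (\<exists>m. I = {..<m})) \<and> inj_on U I \<and> measurable_partition M A (U ` I)"

text \<open>The limit process shared by both Birkhoff integrals over \<open>A\<close>, where \<open>S \<omega> U\<close> is the summand
  belonging to a cell \<open>U\<close> with tag \<open>\<omega>\<close>. For a finite partition the partial sums are eventually
  the full sum, so the limsup is then the norm of a single difference. Only the measurable
  sets of \<open>M\<close> are used.\<close>

definition birkhoff_limit ::
    "'a measure \<Rightarrow> 'a set \<Rightarrow> ('a \<Rightarrow> 'a set \<Rightarrow> 'b::banach) \<Rightarrow> 'b \<Rightarrow> bool" where
  "birkhoff_limit M A S J \<longleftrightarrow>
     (\<forall>\<epsilon>>0. \<exists>P. measurable_partition M A P \<and>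
       (\<forall>I U \<omega>. partition_enumeration M A I U \<and> refines A (U ` I) P \<and> (\<forall>k\<in>I. \<omega> k \<in> U k) \<longrightarrow>
          limsup (\<lambda>n. ereal (norm ((\<Sum>k\<in>I \<inter> {..<n}. S (\<omega> k) (U k)) - J))) < ereal \<epsilon>))"

definition has_bi1_integral :: "'a measure \<Rightarrow> 'a set \<Rightarrow> ('a \<Rightarrow> 'b::banach) \<Rightarrow> 'b \<Rightarrow> bool" where
  "has_bi1_integral M A f J \<longleftrightarrow> birkhoff_limit M A (\<lambda>\<omega> U. measure M U *\<^sub>R f \<omega>) J"

definition bi1_integrable :: "'a measure \<Rightarrow> 'a set \<Rightarrow> ('a \<Rightarrow> 'b::banach) \<Rightarrow> bool" where
  "bi1_integrable M A f \<longleftrightarrow> (\<exists>J. has_bi1_integral M A f J)"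

definition bi1_integral :: "'a measure \<Rightarrow> 'a set \<Rightarrow> ('a \<Rightarrow> 'b::banach) \<Rightarrow> 'b" where
  "bi1_integral M A f = (THE J. has_bi1_integral M A f J)"

definition has_bi2_integral ::
    "'a measure \<Rightarrow> 'a set \<Rightarrow> ('a set \<Rightarrow> 'b::banach) \<Rightarrow> ('a \<Rightarrow> real) \<Rightarrow> 'b \<Rightarrow> bool" where
  "has_bi2_integral M A N g J \<longleftrightarrow> birkhoff_limit M A (\<lambda>\<omega> U. g \<omega> *\<^sub>R N U) J"

definition bi2_integrable ::
    "'a measure \<Rightarrow> 'a set \<Rightarrow> ('a set \<Rightarrow> 'b::banach) \<Rightarrow> ('a \<Rightarrow> real) \<Rightarrow> bool" where
  "bi2_integrable M A N g \<longleftrightarrow> (\<exists>J. has_bi2_integral M A N g J)"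

definition bi2_integral ::
    "'a measure \<Rightarrow> 'a set \<Rightarrow> ('a set \<Rightarrow> 'b::banach) \<Rightarrow> ('a \<Rightarrow> real) \<Rightarrow> 'b" where
  "bi2_integral M A N g = (THE J. has_bi2_integral M A N g J)"

end

theory Submission
  imports Defs
begin

text \<open>
  Write \<open>\<nu>\<close> for the finite measure \<open>M\<close>. Both Birkhoff integrals in the theorem are limits of sums over
  the same tagged countable partitions; a cell \<open>W\<close> with tag \<open>\<omega>\<close> contributes
  \<open>\<nu>(W) \<phi>(\<omega>) \<Phi>(\<omega>)\<close> to the first sum and \<open>\<phi>(\<omega>) N(W)\<close> to the second. The proof shows that on
  sufficiently fine partitions these two contributions differ by at most \<open>\<epsilon> \<nu>(W)\<close>. All partial sums
  then differ by at most \<open>\<epsilon> \<nu>(\<Omega>)\<close>, so a vector is the limit of the first kind of sum if and only if it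
  is the limit of the second (\<open>birkhoff_limit_transfer\<close>). This gives both the equivalence and the
  equality of the integrals.

  The partition comes from strong measurability: off a null set the range of \<open>\<Phi>\<close> lies in a separable
  set, so countably many small balls cover it. Splitting \<open>\<Omega>\<close> first along the integer part of
  \<open>\<bar>\<phi>\<bar>\<close> allows the radius to shrink as \<open>\<bar>\<phi>\<bar>\<close> grows, and yields cells that are either null or satisfy
  \<open>(1 + \<bar>\<phi>(x)\<bar>) \<parallel>\<Phi>(x) - \<Phi>(y)\<parallel> \<le> \<epsilon>\<close> (\<open>strongly_measurable_fine_partition\<close>).

  On a subset \<open>W\<close> of such a cell, a mean value estimate (\<open>bi1_integral_mean_value\<close>) gives
  \<open>\<parallel>\<nu>(W) \<Phi>(\<omega>) - N(W)\<parallel> \<le> \<epsilon> \<nu>(W) / (1 + \<bar>\<phi>(\<omega>)\<bar>)\<close>, and multiplication by \<open>\<bar>\<phi>(\<omega>)\<bar>\<close> keeps the right hand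
  side below \<open>\<epsilon> \<nu>(W)\<close>. The estimate speaks about an integral that exists. On a non-null cell \<open>\<Phi>\<close> is
  bounded and has partitions of arbitrarily small oscillation, so its Birkhoff sums form a Cauchy
  family in the Banach space (\<open>bi1_integrable_of_fine_partitions\<close>); on a null cell all sums vanish. In
  both cases \<open>N(W)\<close> is the value of the integral because the limit is unique.
\<close>

section \<open>Tagged refinements\<close>

definition tagged_refinement ::
    "'a measure \<Rightarrow> 'a set \<Rightarrow> 'a set set \<Rightarrow> nat set \<Rightarrow> (nat \<Rightarrow> 'a set) \<Rightarrow> (nat \<Rightarrow> 'a) \<Rightarrow> bool" where
  "tagged_refinement M A P I U \<omega> \<longleftrightarrow>
     partition_enumeration M A I U \<and> refines A (U ` I) P \<and> (\<forall>k\<in>I. \<omega> k \<in> U k)"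

text \<open>A strict bound on the limit superior says slightly more than the same bound holding eventually, but
  the loss disappears on halving \<open>\<epsilon>\<close>. The eventual form is easier to combine across several sums.\<close>

lemma birkhoff_limit_iff_eventually:
  "birkhoff_limit M A S J \<longleftrightarrow>
     (\<forall>\<epsilon>>0. \<exists>P. measurable_partition M A P \<and>
       (\<forall>I U \<omega>. tagged_refinement M A P I U \<omega> \<longrightarrow>
          (\<forall>\<^sub>F n in sequentially. norm ((\<Sum>k\<in>I \<inter> {..<n}. S (\<omega> k) (U k)) - J) < \<epsilon>)))"
  (is "?L \<longleftrightarrow> ?R")
proof
  assume ?L
  then show ?R
    unfolding birkhoff_limit_def tagged_refinement_def
    by (fastforce dest: Limsup_lessD)
next
  assume R: ?R
  show ?L
    unfolding birkhoff_limit_def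
  proof (intro allI impI)
    fix \<epsilon> :: real assume "\<epsilon> > 0"
    with R[rule_format, of "\<epsilon>/2"] obtain P where P: "measurable_partition M A P"
      and ev: "\<And>I U \<omega>. tagged_refinement M A P I U \<omega> \<Longrightarrow>
          (\<forall>\<^sub>F n in sequentially. norm ((\<Sum>k\<in>I \<inter> {..<n}. S (\<omega> k) (U k)) - J) < \<epsilon>/2)"
      by auto
    have "limsup (\<lambda>n. ereal (norm ((\<Sum>k\<in>I \<inter> {..<n}. S (\<omega> k) (U k)) - J))) < ereal \<epsilon>"
      if "tagged_refinement M A P I U \<omega>" for I U \<omega>
    proof -
      have "limsup (\<lambda>n. ereal (norm ((\<Sum>k\<in>I \<inter> {..<n}. S (\<omega> k) (U k)) - J))) \<le> ereal (\<epsilon>/2)"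
        by (rule Limsup_bounded, rule eventually_mono[OF ev[OF that]]) auto
      also have "\<dots> < ereal \<epsilon>" using \<open>\<epsilon> > 0\<close> by simp
      finally show ?thesis .
    qed
    with P show "\<exists>P. measurable_partition M A P \<and>
       (\<forall>I U \<omega>. partition_enumeration M A I U \<and> refines A (U ` I) P \<and> (\<forall>k\<in>I. \<omega> k \<in> U k) \<longrightarrow>
          limsup (\<lambda>n. ereal (norm ((\<Sum>k\<in>I \<inter> {..<n}. S (\<omega> k) (U k)) - J))) < ereal \<epsilon>)"
      unfolding tagged_refinement_def by blast
  qed
qed

lemma measurable_partition_sets: "measurable_partition M A P \<Longrightarrow> A \<in> sets M"
  unfolding measurable_partition_def partition_on_def
  by (auto intro: sets.countable_Union)

lemma measurable_partition_common_refinement: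
  assumes P: "measurable_partition M A P" and Q: "measurable_partition M A Q"
  obtains R where "measurable_partition M A R" "refines A R P" "refines A R Q"
proof
  let ?R = "common_refinement {P, Q}"
  have part: "\<And>T. T \<in> {P, Q} \<Longrightarrow> partition_on A T"
    using P Q by (auto simp: measurable_partition_def)
  have sub: "?R \<subseteq> (\<lambda>(V, W). V \<inter> W) ` (P \<times> Q)"
    unfolding common_refinement by (fastforce simp: Pi_iff)
  moreover have "countable ((\<lambda>(V, W). V \<inter> W) ` (P \<times> Q))"
    using P Q by (auto simp: measurable_partition_def)
  ultimately have "countable ?R" by (rule countable_subset)
  moreover have "?R \<subseteq> sets M"
    using sub P Q by (fastforce simp: measurable_partition_def)
  ultimately show "measurable_partition M A ?R"
    using partition_on_common_refinement[OF part, of "{P, Q}"] by (auto simp: measurable_partition_def)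
  show "refines A ?R P" "refines A ?R Q"
    by (auto intro!: refines_common_refinement part)
qed

lemma measurable_partition_restrict:
  assumes "measurable_partition M A P" "B \<in> sets M" "B \<subseteq> A"
  shows "measurable_partition M B ((\<inter>) B ` P - {{}})"
  using assms partition_on_restrict[of A P B]
  by (auto simp: measurable_partition_def Int_absorb2)

text \<open>Limits over refinements would be vacuous if some partition had no enumeration. Here it matters that
  an index set may be a finite initial segment, since a finite partition cannot be enumerated
  injectively by all natural numbers.\<close>

lemma tagged_refinement_exists:
  assumes "measurable_partition M A P"
  obtains I U \<omega> where "tagged_refinement M A P I U \<omega>"
proof -
  have part: "partition_on A P" and cnt: "countable P"
    using assms by (auto simp: measurable_partition_def)
  obtain I :: "nat set" and U where IU: "I = UNIV \<or> (\<exists>m. I = {..<m})" "bij_betw U I P"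
  proof (cases "finite P")
    case True
    then obtain h where "bij_betw h {0..<card P} P" using ex_bij_betw_nat_finite by blast
    then show ?thesis using that[of "{..<card P}" h] by (auto simp: atLeast0LessThan)
  next
    case False
    then show ?thesis using that[of UNIV "from_nat_into P"] bij_betw_from_nat_into[OF cnt] by auto
  qed
  have ne: "\<And>k. k \<in> I \<Longrightarrow> U k \<noteq> {}"
    using IU(2) part by (auto simp: bij_betw_def partition_on_def)
  \<comment> \<open>The tags exist because the members of a partition are non-empty.\<close>
  have "tagged_refinement M A P I U (\<lambda>k. SOME x. x \<in> U k)"
    unfolding tagged_refinement_def partition_enumeration_def
    using IU assms refines_refl[OF part] ne some_in_eq by (auto simp: bij_betw_def)
  then show ?thesis by (rule that)
qed

lemma tagged_refinement_mono:
  assumes "tagged_refinement M A R I U \<omega>" "refines A R P"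
  shows "tagged_refinement M A P I U \<omega>"
  using assms refines_trans unfolding tagged_refinement_def by blast

lemma tagged_refinementD:
  assumes "tagged_refinement M A P I U \<omega>"
  shows "disjoint_family_on U I" "(\<Union>k\<in>I. U k) = A" "\<And>k. k \<in> I \<Longrightarrow> U k \<in> sets M"
    "\<And>k. k \<in> I \<Longrightarrow> \<omega> k \<in> U k" "\<And>k. k \<in> I \<Longrightarrow> \<exists>V\<in>P. U k \<subseteq> V"
proof -
  have *: "inj_on U I" "partition_on A (U ` I)" "U ` I \<subseteq> sets M" "refines A (U ` I) P"
    using assms
    by (auto simp: tagged_refinement_def partition_enumeration_def measurable_partition_def)
  show "disjoint_family_on U I"
    using *(1,2) unfolding disjoint_family_on_def partition_on_def disjoint_def inj_on_def
    by (metis image_eqI)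
  show "(\<Union>k\<in>I. U k) = A" using * by (auto simp: partition_on_def)
  show "\<And>k. k \<in> I \<Longrightarrow> U k \<in> sets M" using * by auto
  show "\<And>k. k \<in> I \<Longrightarrow> \<omega> k \<in> U k" using assms by (auto simp: tagged_refinement_def)
  show "\<And>k. k \<in> I \<Longrightarrow> \<exists>V\<in>P. U k \<subseteq> V" using * by (auto simp: refines_def)
qed

text \<open>Two partitions have a common refinement, and a single tagged sum over it is close to both limits.\<close>

lemma birkhoff_limit_unique:
  assumes "birkhoff_limit M A S J" "birkhoff_limit M A S J'"
  shows "J = J'"
proof (rule ccontr)
  assume "J \<noteq> J'"
  define e where "e = norm (J - J') / 2"
  have "e > 0" using \<open>J \<noteq> J'\<close> by (simp add: e_def)
  obtain P where P: "measurable_partition M A P"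
    "\<And>I U \<omega>. tagged_refinement M A P I U \<omega> \<Longrightarrow>
       (\<forall>\<^sub>F n in sequentially. norm ((\<Sum>k\<in>I \<inter> {..<n}. S (\<omega> k) (U k)) - J) < e)"
    using assms(1) \<open>e > 0\<close> unfolding birkhoff_limit_iff_eventually by meson
  obtain Q where Q: "measurable_partition M A Q"
    "\<And>I U \<omega>. tagged_refinement M A Q I U \<omega> \<Longrightarrow>
       (\<forall>\<^sub>F n in sequentially. norm ((\<Sum>k\<in>I \<inter> {..<n}. S (\<omega> k) (U k)) - J') < e)"
    using assms(2) \<open>e > 0\<close> unfolding birkhoff_limit_iff_eventually by meson
  obtain R where R: "measurable_partition M A R" "refines A R P" "refines A R Q"
    using measurable_partition_common_refinement[OF P(1) Q(1)] .
  obtain I U \<omega> where T: "tagged_refinement M A R I U \<omega>"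
    using tagged_refinement_exists[OF R(1)] .
  define s where "s n = (\<Sum>k\<in>I \<inter> {..<n}. S (\<omega> k) (U k))" for n
  have "\<forall>\<^sub>F n in sequentially. norm (s n - J) < e \<and> norm (s n - J') < e"
    unfolding s_def
    using P(2)[OF tagged_refinement_mono[OF T R(2)]] Q(2)[OF tagged_refinement_mono[OF T R(3)]]
    by (rule eventually_conj)
  then obtain n where "norm (s n - J) < e" "norm (s n - J') < e"
    using eventually_happens[of _ sequentially] by auto
  then have "norm (J - J') < 2 * e"
    by norm
  then show False by (simp add: e_def)
qed

section \<open>Sums over countable families of cells\<close>

lemma (in finite_measure) has_sum_measure_UN:
  fixes U :: "nat \<Rightarrow> 'a set"
  assumes "disjoint_family_on U I" "\<And>k. k \<in> I \<Longrightarrow> U k \<in> sets M"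
  shows "((\<lambda>k. measure M (U k)) has_sum measure M (\<Union>k\<in>I. U k)) I"
proof -
  define V where "V k = (if k \<in> I then U k else {})" for k
  have "range V \<subseteq> sets M" "disjoint_family V"
    using assms by (auto simp: V_def disjoint_family_on_def)
  then have "(\<lambda>k. measure M (V k)) sums measure M (\<Union>k. V k)" by (rule finite_measure_UNION)
  then have "((\<lambda>k. measure M (V k)) has_sum measure M (\<Union>k. V k)) UNIV"
    by (rule sums_nonneg_imp_has_sum) simp
  moreover have "(\<Union>k. V k) = (\<Union>k\<in>I. U k)" by (auto simp: V_def)
  ultimately show ?thesis
    by (subst has_sum_cong_neutral[of UNIV I "\<lambda>k. measure M (V k)"]) (auto simp: V_def)
qed

lemma has_sum_imp_partial_sums_tendsto:
  fixes g :: "nat \<Rightarrow> 'b::real_normed_vector"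
  assumes "(g has_sum S) I"
  shows "(\<lambda>n. \<Sum>k\<in>I \<inter> {..<n}. g k) \<longlonglongrightarrow> S"
proof -
  have "((\<lambda>k. if k \<in> I then g k else 0) has_sum S) UNIV"
    by (rule has_sum_cong_neutral[THEN iffD1, OF _ _ _ assms]) auto
  from has_sum_imp_sums[OF this] show ?thesis
    unfolding sums_def by (simp add: sum.inter_restrict[symmetric] Int_commute)
qed

lemma (in finite_measure) weighted_sum_summable:
  fixes U :: "nat \<Rightarrow> 'a set" and a :: "nat \<Rightarrow> 'b::banach"
  assumes "disjoint_family_on U I" "\<And>k. k \<in> I \<Longrightarrow> U k \<in> sets M"
    and "\<And>k. k \<in> I \<Longrightarrow> norm (a k) \<le> B"
  shows "(\<lambda>k. measure M (U k) *\<^sub>R a k) summable_on I"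
proof (rule Infinite_Sum.abs_summable_summable, rule Infinite_Sum.abs_summable_on_comparison_test)
  show "(\<lambda>k. norm (measure M (U k) * B)) summable_on I"
    using has_sum_measure_UN[OF assms(1,2)]
    by (auto simp: abs_mult summable_on_def intro!: summable_on_cmult_left[unfolded summable_on_def])
  show "norm (measure M (U k) *\<^sub>R a k) \<le> norm (measure M (U k) * B)" if "k \<in> I" for k
    using assms(3)[OF that] norm_ge_zero[of "a k"]
    by (simp add: abs_mult mult_left_mono)
qed

text \<open>Two sums over different families of cells are compared on the cells \<open>U i \<inter> V j\<close>. There both become
  sums over the product index set with the same weights, hence only the values \<open>a i\<close> and \<open>b j\<close> on
  cells that meet in positive measure have to be close. Absolute convergence, which the bound \<open>B\<close>
  provides, justifies regrouping the double sums by rows and by columns.\<close>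

lemma (in finite_measure) weighted_sums_close:
  fixes U V :: "nat \<Rightarrow> 'a set" and a b :: "nat \<Rightarrow> 'b::banach"
  assumes U: "disjoint_family_on U I" "(\<Union>i\<in>I. U i) = A" "\<And>i. i \<in> I \<Longrightarrow> U i \<in> sets M"
    and V: "disjoint_family_on V K" "(\<Union>j\<in>K. V j) = A" "\<And>j. j \<in> K \<Longrightarrow> V j \<in> sets M"
    and a: "\<And>i. i \<in> I \<Longrightarrow> norm (a i) \<le> B" and b: "\<And>j. j \<in> K \<Longrightarrow> norm (b j) \<le> B"
    and close: "\<And>i j. i \<in> I \<Longrightarrow> j \<in> K \<Longrightarrow> measure M (U i \<inter> V j) \<noteq> 0 \<Longrightarrow> norm (a i - b j) \<le> d"
    and S: "((\<lambda>i. measure M (U i) *\<^sub>R a i) has_sum S) I"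
    and T: "((\<lambda>j. measure M (V j) *\<^sub>R b j) has_sum T) K"
  shows "norm (S - T) \<le> d * measure M A"
proof -
  let ?m = "\<lambda>i j. measure M (U i \<inter> V j)"
  \<comment> \<open>Additivity of the measure along the rows and the columns of the grid of intersections.\<close>
  have row: "((\<lambda>j. ?m i j) has_sum measure M (U i)) K" if "i \<in> I" for i
  proof -
    have "(\<Union>j\<in>K. U i \<inter> V j) = U i" using U(2) V(2) that by blast
    with has_sum_measure_UN[of "\<lambda>j. U i \<inter> V j" K] V U(3)[OF that] show ?thesis
      by (auto simp: disjoint_family_on_def)
  qed
  have col: "((\<lambda>i. ?m i j) has_sum measure M (V j)) I" if "j \<in> K" for j
  proof -
    have "(\<Union>i\<in>I. U i \<inter> V j) = V j" using U(2) V(2) that by blast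
    with has_sum_measure_UN[of "\<lambda>i. U i \<inter> V j" I] U V(3)[OF that] show ?thesis
      by (auto simp: disjoint_family_on_def)
  qed
  have tot: "((\<lambda>i. measure M (U i)) has_sum measure M A) I"
    using has_sum_measure_UN[OF U(1,3)] U(2) by simp
  have sm: "(\<lambda>(i, j). ?m i j) summable_on I \<times> K"
    by (rule summable_on_SigmaI[where g = "\<lambda>i. measure M (U i)"])
      (use row tot in \<open>auto intro: has_sum_imp_summable\<close>)
  have m: "((\<lambda>(i, j). ?m i j) has_sum measure M A) (I \<times> K)"
    by (rule has_sum_SigmaI[OF _ tot sm]) (use row in auto)
  have smB: "(\<lambda>p. norm ((case p of (i, j) \<Rightarrow> ?m i j) * B)) summable_on I \<times> K"
    using sm by (auto simp: abs_mult case_prod_unfold intro!: summable_on_cmult_left)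
  have "(\<lambda>(i, j). ?m i j *\<^sub>R a i) summable_on I \<times> K"
    by (rule Infinite_Sum.abs_summable_summable, rule Infinite_Sum.abs_summable_on_comparison_test[OF smB])
      (auto simp: abs_mult intro!: mult_left_mono order_trans[OF a abs_ge_self])
  then obtain S' where S': "((\<lambda>(i, j). ?m i j *\<^sub>R a i) has_sum S') (I \<times> K)"
    by (auto simp: summable_on_def)
  \<comment> \<open>Summing the double series by rows recovers \<open>S\<close>; summing the one for \<open>b\<close> by columns recovers \<open>T\<close>.\<close>
  have "((\<lambda>i. measure M (U i) *\<^sub>R a i) has_sum S') I"
    by (rule has_sum_SigmaD[OF S'])
      (use row has_sum_bounded_linear[OF bounded_linear_scaleR_left] in fastforce)
  with S have "S' = S" using has_sum_unique by blast
  have "(\<lambda>(i, j). ?m i j *\<^sub>R b j) summable_on I \<times> K"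
    by (rule Infinite_Sum.abs_summable_summable, rule Infinite_Sum.abs_summable_on_comparison_test[OF smB])
      (auto simp: abs_mult intro!: mult_left_mono order_trans[OF b abs_ge_self])
  then obtain T' where T': "((\<lambda>(i, j). ?m i j *\<^sub>R b j) has_sum T') (I \<times> K)"
    by (auto simp: summable_on_def)
  have "((\<lambda>(j, i). ?m i j *\<^sub>R b j) has_sum T') (K \<times> I)"
    using T' by (subst (asm) has_sum_swap) (simp add: case_prod_unfold)
  then have "((\<lambda>j. measure M (V j) *\<^sub>R b j) has_sum T') K"
    by (rule has_sum_SigmaD)
      (use col has_sum_bounded_linear[OF bounded_linear_scaleR_left] in fastforce)
  with T have "T' = T" using has_sum_unique by blast
  have minus: "((\<lambda>p. - (case p of (i, j) \<Rightarrow> ?m i j *\<^sub>R b j)) has_sum - T') (I \<times> K)"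
    unfolding has_sum_uminus using T' by simp
  show ?thesis
  proof (rule norm_infsum_le)
    show "((\<lambda>(i, j). ?m i j *\<^sub>R (a i - b j)) has_sum S - T) (I \<times> K)"
      using has_sum_add[OF S' minus] \<open>S' = S\<close> \<open>T' = T\<close>
      by (simp add: case_prod_unfold scaleR_diff_right)
    show "((\<lambda>(i, j). d * ?m i j) has_sum d * measure M A) (I \<times> K)"
      using has_sum_cmult_right[OF m, of d] by (simp add: case_prod_unfold)
    fix p assume "p \<in> I \<times> K"
    then obtain i j where p: "p = (i, j)" "i \<in> I" "j \<in> K" by blast
    have "?m i j * norm (a i - b j) \<le> ?m i j * d"
      using close[OF p(2,3)] by (cases "?m i j = 0") (auto intro: mult_left_mono)
    then show "norm (case p of (i, j) \<Rightarrow> ?m i j *\<^sub>R (a i - b j)) \<le> (case p of (i, j) \<Rightarrow> d * ?m i j)"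
      by (simp add: p(1) mult.commute)
  qed
qed

section \<open>The first Birkhoff integral of a function with fine partitions\<close>

text \<open>Null cells count as having small oscillation whatever \<open>f\<close> does on them: they contribute nothing to a
  sum of the first type, and strong measurability restricts \<open>f\<close> only outside a null set.\<close>

definition oscillation_le :: "'a measure \<Rightarrow> ('a \<Rightarrow> 'b::banach) \<Rightarrow> real \<Rightarrow> 'a set \<Rightarrow> bool" where
  "oscillation_le M f e V \<longleftrightarrow> measure M V = 0 \<or> (\<forall>x\<in>V. \<forall>y\<in>V. norm (f x - f y) \<le> e)"

lemma (in finite_measure) oscillation_le_subset:
  assumes "oscillation_le M f e V" "W \<subseteq> V" "V \<in> sets M"
  shows "oscillation_le M f e W"
proof (cases "measure M V = 0")
  case True
  then have "measure M W = 0"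
    using finite_measure_mono[OF assms(2,3)] measure_nonneg[of M W] by simp
  then show ?thesis by (simp add: oscillation_le_def)
next
  case False
  then show ?thesis using assms by (auto simp: oscillation_le_def)
qed

lemma (in finite_measure) oscillation_le_tagged_refinement:
  assumes "tagged_refinement M A P I U \<omega>" "measurable_partition M A P"
    and "\<And>V. V \<in> P \<Longrightarrow> oscillation_le M f e V" "k \<in> I"
  shows "oscillation_le M f e (U k)"
  using tagged_refinementD(5)[OF assms(1,4)] assms(2,3) oscillation_le_subset
  unfolding measurable_partition_def by (metis subsetD)

lemma (in finite_measure) bi1_sum_exists:
  fixes f :: "'a \<Rightarrow> 'b::banach"
  assumes T: "tagged_refinement M A P I U \<omega>" and B: "\<And>x. x \<in> A \<Longrightarrow> norm (f x) \<le> B"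
  obtains S where "((\<lambda>k. measure M (U k) *\<^sub>R f (\<omega> k)) has_sum S) I"
proof -
  have "(\<lambda>k. measure M (U k) *\<^sub>R f (\<omega> k)) summable_on I"
    using tagged_refinementD[OF T] by (intro weighted_sum_summable[where B = B] B) auto
  then show ?thesis using that by (auto simp: summable_on_def)
qed

text \<open>If a cell of one partition meets a cell of the other in positive measure, then neither is null and both tags can be
  compared with a common point; the two oscillation bounds add up.\<close>

lemma (in finite_measure) bi1_sums_close:
  fixes f :: "'a \<Rightarrow> 'b::banach"
  assumes B: "\<And>x. x \<in> A \<Longrightarrow> norm (f x) \<le> B"
    and T: "tagged_refinement M A P I U \<omega>" and T': "tagged_refinement M A P' K V \<tau>"
    and osc: "\<And>i. i \<in> I \<Longrightarrow> oscillation_le M f d (U i)"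
    and osc': "\<And>j. j \<in> K \<Longrightarrow> oscillation_le M f d' (V j)"
    and S: "((\<lambda>k. measure M (U k) *\<^sub>R f (\<omega> k)) has_sum S) I"
    and S': "((\<lambda>k. measure M (V k) *\<^sub>R f (\<tau> k)) has_sum S') K"
  shows "norm (S - S') \<le> (d + d') * measure M A"
proof (rule weighted_sums_close[OF tagged_refinementD(1-3)[OF T] tagged_refinementD(1-3)[OF T'] _ _ _ S S'])
  show "norm (f (\<omega> i)) \<le> B" if "i \<in> I" for i
    using tagged_refinementD(2,4)[OF T] that B by blast
  show "norm (f (\<tau> j)) \<le> B" if "j \<in> K" for j
    using tagged_refinementD(2,4)[OF T'] that B by blast
  fix i j assume ij: "i \<in> I" "j \<in> K" and nz: "measure M (U i \<inter> V j) \<noteq> 0"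
  have "measure M (U i \<inter> V j) \<le> measure M (U i)" "measure M (U i \<inter> V j) \<le> measure M (V j)"
    using tagged_refinementD(3)[OF T ij(1)] tagged_refinementD(3)[OF T' ij(2)]
    by (auto intro!: finite_measure_mono)
  then have "measure M (U i) \<noteq> 0" "measure M (V j) \<noteq> 0"
    using nz measure_nonneg[of M "U i \<inter> V j"] by linarith+
  moreover obtain z where "z \<in> U i" "z \<in> V j"
    using nz by (metis Int_iff all_not_in_conv measure_empty)
  ultimately have "norm (f (\<omega> i) - f z) \<le> d" "norm (f z - f (\<tau> j)) \<le> d'"
    using osc[OF ij(1)] osc'[OF ij(2)] tagged_refinementD(4)[OF T ij(1)]
      tagged_refinementD(4)[OF T' ij(2)] by (auto simp: oscillation_le_def)
  then show "norm (f (\<omega> i) - f (\<tau> j)) \<le> d + d'"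
    by norm
qed

text \<open>Choose one tagged sum \<open>S n\<close> over a partition of oscillation \<open>1/(n+1)\<close>. By
  \<open>bi1_sums_close\<close> the sequence is Cauchy, so it converges in the Banach space, and every sum over a
  refinement of the \<open>n\<close>-th partition is close to \<open>S n\<close> and hence to the limit.\<close>

lemma (in finite_measure) bi1_integrable_of_fine_partitions:
  fixes f :: "'a \<Rightarrow> 'b::banach"
  assumes B: "\<And>x. x \<in> A \<Longrightarrow> norm (f x) \<le> B"
    and fine: "\<And>e. e > 0 \<Longrightarrow> \<exists>P. measurable_partition M A P \<and> (\<forall>V\<in>P. oscillation_le M f e V)"
  shows "bi1_integrable M A f"
proof -
  define d where "d n = inverse (real (Suc n))" for n
  have d: "d n > 0" for n by (simp add: d_def)
  have dlim: "d \<longlonglongrightarrow> 0" unfolding d_def by (rule LIMSEQ_inverse_real_of_nat)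
  have "\<forall>n. \<exists>P. measurable_partition M A P \<and> (\<forall>V\<in>P. oscillation_le M f (d n) V)"
    using fine d by blast
  then obtain P where P: "\<And>n. measurable_partition M A (P n)"
    "\<And>n V. V \<in> P n \<Longrightarrow> oscillation_le M f (d n) V"
    by metis
  have "\<exists>I U \<omega> S. tagged_refinement M A (P n) I U \<omega>
      \<and> ((\<lambda>k. measure M (U k) *\<^sub>R f (\<omega> k)) has_sum S) I" for n
  proof -
    obtain I U \<omega> where T: "tagged_refinement M A (P n) I U \<omega>"
      using tagged_refinement_exists[OF P(1)] .
    obtain S where "((\<lambda>k. measure M (U k) *\<^sub>R f (\<omega> k)) has_sum S) I"
      using bi1_sum_exists[OF T B] .
    with T show ?thesis by blast
  qed
  then obtain I U \<omega> S where T: "\<And>n. tagged_refinement M A (P n) (I n) (U n) (\<omega> n)"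
    and S: "\<And>n. ((\<lambda>k. measure M (U n k) *\<^sub>R f (\<omega> n k)) has_sum S n) (I n)"
    by metis
  have osc: "oscillation_le M f (d n) (W k)" if "tagged_refinement M A (P n) K W \<tau>" "k \<in> K" for n K W \<tau> k
    using oscillation_le_tagged_refinement[OF that(1) P(1) _ that(2)] P(2) by blast
  have close: "norm (S n - S m) \<le> (d n + d m) * measure M A" for n m
    by (rule bi1_sums_close[OF B T T osc[OF T] osc[OF T] S S])
  have "Cauchy S"
  proof (rule metric_CauchyI)
    fix e :: real assume "e > 0"
    have "(\<lambda>n. d n * measure M A) \<longlonglongrightarrow> 0 * measure M A" by (intro tendsto_intros dlim)
    then have "\<forall>\<^sub>F n in sequentially. d n * measure M A < e / 2"
      by (rule order_tendstoD) (use \<open>e > 0\<close> in simp)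
    then obtain n0 where n0: "\<And>n. n \<ge> n0 \<Longrightarrow> d n * measure M A < e / 2"
      by (auto simp: eventually_sequentially)
    have "dist (S m) (S n) < e" if "m \<ge> n0" "n \<ge> n0" for m n
      using close[of m n] n0[OF that(1)] n0[OF that(2)] by (simp add: dist_norm distrib_right)
    then show "\<exists>n0. \<forall>m\<ge>n0. \<forall>n\<ge>n0. dist (S m) (S n) < e" by blast
  qed
  then obtain J where J: "S \<longlonglongrightarrow> J"
    using Cauchy_convergent convergent_def by blast
  have "has_bi1_integral M A f J"
    unfolding has_bi1_integral_def birkhoff_limit_iff_eventually
  proof (intro allI impI)
    fix e :: real assume "e > 0"
    have "(\<lambda>n. 2 * d n * measure M A + norm (S n - J)) \<longlonglongrightarrow> 2 * 0 * measure M A + norm (J - J)"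
      by (intro tendsto_intros dlim J)
    then have "\<forall>\<^sub>F n in sequentially. 2 * d n * measure M A + norm (S n - J) < e"
      by (rule order_tendstoD) (use \<open>e > 0\<close> in simp)
    then obtain n where n: "2 * d n * measure M A + norm (S n - J) < e"
      by (auto simp: eventually_sequentially)
    have "\<forall>\<^sub>F m in sequentially. norm ((\<Sum>k\<in>K \<inter> {..<m}. measure M (W k) *\<^sub>R f (\<tau> k)) - J) < e"
      if T': "tagged_refinement M A (P n) K W \<tau>" for K W \<tau>
    proof -
      obtain R where R: "((\<lambda>k. measure M (W k) *\<^sub>R f (\<tau> k)) has_sum R) K"
        using bi1_sum_exists[where f = f, OF T' B] .
      have "norm (R - S n) \<le> (d n + d n) * measure M A"
        by (rule bi1_sums_close[OF B T' T osc[OF T'] osc[OF T] R S])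
      then have "norm (R - S n) + norm (S n - J) < e"
        using n by (simp add: distrib_right)
      then have "norm (R - J) < e" by norm
      moreover have "(\<lambda>m. norm ((\<Sum>k\<in>K \<inter> {..<m}. measure M (W k) *\<^sub>R f (\<tau> k)) - J))
          \<longlonglongrightarrow> norm (R - J)"
        by (intro tendsto_intros has_sum_imp_partial_sums_tendsto R)
      ultimately show ?thesis by (auto intro: order_tendstoD)
    qed
    with P(1) show "\<exists>P. measurable_partition M A P \<and>
       (\<forall>I U \<omega>. tagged_refinement M A P I U \<omega> \<longrightarrow>
          (\<forall>\<^sub>F n in sequentially. norm ((\<Sum>k\<in>I \<inter> {..<n}. measure M (U k) *\<^sub>R f (\<omega> k)) - J) < e))"
      by blast
  qed
  then show ?thesis by (auto simp: bi1_integrable_def)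
qed

text \<open>The vector \<open>measure M A *\<^sub>R c\<close> is the Birkhoff sum of the constant \<open>c\<close> for the partition of \<open>A\<close> into
  a single cell, so it is comparable with any sum that approximates \<open>J\<close>.\<close>

lemma (in finite_measure) bi1_integral_mean_value:
  fixes f :: "'a \<Rightarrow> 'b::banach"
  assumes J: "has_bi1_integral M A f J" and c: "\<And>x. x \<in> A \<Longrightarrow> norm (f x - c) \<le> d"
  shows "norm (measure M A *\<^sub>R c - J) \<le> d * measure M A"
proof (rule field_le_epsilon)
  fix e :: real assume "e > 0"
  with J obtain P where P: "measurable_partition M A P"
    and ev: "\<And>I U \<omega>. tagged_refinement M A P I U \<omega> \<Longrightarrow>
      \<forall>\<^sub>F n in sequentially. norm ((\<Sum>k\<in>I \<inter> {..<n}. measure M (U k) *\<^sub>R f (\<omega> k)) - J) < e"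
    unfolding has_bi1_integral_def birkhoff_limit_iff_eventually by meson
  obtain I U \<omega> where T: "tagged_refinement M A P I U \<omega>"
    using tagged_refinement_exists[OF P] .
  have B: "norm (f x) \<le> norm c + d" if "x \<in> A" for x
    using c[OF that] norm_triangle_sub[of "f x" c] by linarith
  obtain S where S: "((\<lambda>k. measure M (U k) *\<^sub>R f (\<omega> k)) has_sum S) I"
    using bi1_sum_exists[OF T B] .
  have "(\<lambda>m. norm ((\<Sum>k\<in>I \<inter> {..<m}. measure M (U k) *\<^sub>R f (\<omega> k)) - J)) \<longlonglongrightarrow> norm (S - J)"
    by (intro tendsto_intros has_sum_imp_partial_sums_tendsto S)
  then have le: "norm (S - J) \<le> e"
    by (rule tendsto_upperbound) (use eventually_mono[OF ev[OF T]] in \<open>auto simp: less_imp_le\<close>)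
  have tag: "\<omega> k \<in> A" if "k \<in> I" for k
    using tagged_refinementD(2,4)[OF T] that by blast
  have "norm (S - measure M A *\<^sub>R c) \<le> d * measure M A"
  proof (rule weighted_sums_close[OF tagged_refinementD(1-3)[OF T], where K = "{0}" and V = "\<lambda>_. A"
        and b = "\<lambda>_. c" and B = "norm c + \<bar>d\<bar>", OF _ _ _ _ _ _ _ S])
    show "norm (f (\<omega> i)) \<le> norm c + \<bar>d\<bar>" if "i \<in> I" for i
      using B[OF tag[OF that]] by linarith
    show "norm (f (\<omega> i) - c) \<le> d" if "i \<in> I" for i
      using c[OF tag[OF that]] .
    show "((\<lambda>j. measure M A *\<^sub>R c) has_sum measure M A *\<^sub>R c) {0::nat}"
      using has_sum_finite[of "{0::nat}" "\<lambda>_. measure M A *\<^sub>R c"] by simp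
  qed (use measurable_partition_sets[OF P] in \<open>auto simp: disjoint_family_on_def\<close>)
  with le show "norm (measure M A *\<^sub>R c - J) \<le> d * measure M A + e"
    using norm_triangle_ineq4[of "S - J" "S - measure M A *\<^sub>R c"] by simp
qed

lemma (in finite_measure) has_bi1_integral_null:
  fixes f :: "'a \<Rightarrow> 'b::banach"
  assumes A: "A \<in> sets M" "measure M A = 0"
  shows "has_bi1_integral M A f 0"
proof -
  have "measurable_partition M A ({A} - {{}})"
    using A by (auto simp: measurable_partition_def partition_on_def disjoint_def)
  moreover have "(\<Sum>k\<in>I \<inter> {..<n}. measure M (U k) *\<^sub>R f (\<omega> k)) = 0"
    if T: "tagged_refinement M A P I U \<omega>" for P I U \<omega> n
  proof (intro sum.neutral ballI)
    fix k assume k: "k \<in> I \<inter> {..<n}"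
    then have "measure M (U k) \<le> measure M A"
      using tagged_refinementD(2)[OF T] A by (intro finite_measure_mono) auto
    then show "measure M (U k) *\<^sub>R f (\<omega> k) = 0"
      using A(2) measure_nonneg[of M "U k"] by simp
  qed
  ultimately show ?thesis
    unfolding has_bi1_integral_def birkhoff_limit_iff_eventually by auto
qed

lemma bi1_integral_eqI: "has_bi1_integral M A f J \<Longrightarrow> bi1_integral M A f = J"
  unfolding bi1_integral_def has_bi1_integral_def by (metis birkhoff_limit_unique the_equality)

section \<open>Fine partitions for strongly measurable functions\<close>

lemma measurable_partition_fibres:
  fixes c :: "'a \<Rightarrow> 'c::countable"
  assumes "c \<in> measurable M (count_space UNIV)"
  shows "measurable_partition M (space M) (range (\<lambda>v. c -` {v} \<inter> space M) - {{}})"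
  using assms
  by (auto simp: measurable_partition_def partition_on_def disjoint_def intro!: measurable_sets)

text \<open>The countable set is the union of the finite ranges of the approximating simple functions; it is dense
  enough because these converge to \<open>f\<close> off a null set \<open>E\<close>. In a non-separable space the sum of two
  measurable functions may fail to be measurable, so measurability is recorded only for the real
  functions \<open>x \<mapsto> \<parallel>f x - c\<parallel>\<close>, cut off to zero on \<open>E\<close>, which are limits of simple functions.\<close>

lemma strongly_measurable_separable_range:
  fixes f :: "'a \<Rightarrow> 'b::banach"
  assumes "strongly_measurable M f"
  obtains E d where "E \<in> null_sets M"
    and "\<forall>x\<in>space M - E. \<forall>e>0. \<exists>i::nat. norm (f x - d i) < e"
    and "\<forall>c. (\<lambda>x. indicator (space M - E) x * norm (f x - c)) \<in> borel_measurable M"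
proof -
  obtain s where s: "\<And>n. simple_function M (s n)" and conv: "AE x in M. (\<lambda>n. s n x) \<longlonglongrightarrow> f x"
    using assms by (auto simp: strongly_measurable_def)
  from conv obtain E where E: "{x \<in> space M. \<not> (\<lambda>n. s n x) \<longlonglongrightarrow> f x} \<subseteq> E" "emeasure M E = 0" "E \<in> sets M"
    by (rule AE_E)
  have lim: "(\<lambda>n. s n x) \<longlonglongrightarrow> f x" if "x \<in> space M - E" for x using E(1) that by auto
  let ?D = "insert 0 (\<Union>n. s n ` space M)"
  have D: "countable ?D" using s by (auto simp: simple_function_def intro: countable_finite)
  have "\<exists>i. norm (f x - from_nat_into ?D i) < e" if x: "x \<in> space M - E" and "e > 0" for x e
  proof -
    have "\<exists>n. dist (s n x) (f x) < e"
      using lim[OF x] \<open>e > 0\<close> unfolding LIMSEQ_def by blast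
    then obtain n where n: "norm (f x - s n x) < e" by (auto simp: dist_norm norm_minus_commute)
    have "s n x \<in> range (from_nat_into ?D)" using x D by (subst range_from_nat_into) auto
    then show ?thesis using n by auto
  qed
  moreover have "(\<lambda>x. indicator (space M - E) x * norm (f x - c)) \<in> borel_measurable M" for c
  proof (rule borel_measurable_LIMSEQ_real)
    show "(\<lambda>x. indicator (space M - E) x * norm (s n x - c)) \<in> borel_measurable M" for n
      using E(3) simple_function_compose1[OF s, of "\<lambda>y. norm (y - c)" n]
      by (intro borel_measurable_times borel_measurable_indicator borel_measurable_simple_function) auto
    show "(\<lambda>n. indicator (space M - E) x * norm (s n x - c)) \<longlonglongrightarrow> indicator (space M - E) x * norm (f x - c)"
      if "x \<in> space M" for x
      using lim[of x] that by (cases "x \<in> E") (auto intro!: tendsto_intros)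
  qed
  ultimately show ?thesis using that E(2,3) by blast
qed

text \<open>The cells are the fibres of a map with countably many values. It records whether \<open>x\<close> lies in the
  exceptional null set, the integer part \<open>k\<close> of \<open>\<bar>h x\<bar>\<close>, and the first member of a sequence dense
  in the range off that set which is close to \<open>f x\<close>, with a tolerance depending on \<open>k\<close>. For \<open>h = 0\<close> this bounds the plain
  oscillation of \<open>f\<close>.\<close>

lemma strongly_measurable_fine_partition:
  fixes f :: "'a \<Rightarrow> 'b::banach" and h :: "'a \<Rightarrow> real"
  assumes "strongly_measurable M f" and h[measurable]: "h \<in> borel_measurable M" and "e > 0"
  obtains P where "measurable_partition M (space M) P"
    and "\<forall>V\<in>P. measure M V = 0 \<or> (\<forall>x\<in>V. \<forall>y\<in>V. (1 + \<bar>h x\<bar>) * norm (f x - f y) \<le> e)"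
proof -
  obtain E d where E: "E \<in> null_sets M"
    and d: "\<forall>x\<in>space M - E. \<forall>e>0. \<exists>i::nat. norm (f x - d i) < e"
    and m: "\<forall>c. (\<lambda>x. indicator (space M - E) x * norm (f x - c)) \<in> borel_measurable M"
    using strongly_measurable_separable_range[OF assms(1)] .
  note m[rule_format, measurable]
  have [measurable]: "E \<in> sets M" using E by auto
  \<comment> \<open>On level \<open>k\<close> the factor \<open>1 + \<bar>h x\<bar>\<close> is at most \<open>k + 2\<close>, and two points of a ball are
    within twice its radius.\<close>
  define r where "r k = e / (2 * (real k + 2))" for k
  have r: "r k > 0" for k using \<open>e > 0\<close> by (simp add: r_def)
  define level where "level x = nat \<lfloor>\<bar>h x\<bar>\<rfloor>" for x
  \<comment> \<open>On the exceptional set the cut-off makes every index admissible; this keeps the function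
    measurable and does no harm, as these points form null cells.\<close>
  define near where "near x = (LEAST i. indicator (space M - E) x * norm (f x - d i) < r (level x))" for x
  define c where "c x = (x \<in> E, level x, near x)" for x
  have [measurable]: "level \<in> measurable M (count_space UNIV)" unfolding level_def by measurable
  have [measurable]: "(\<lambda>x. r (level x)) \<in> borel_measurable M" by measurable
  have [measurable]: "near \<in> measurable M (count_space UNIV)" unfolding near_def by measurable
  have "c \<in> measurable M (count_space UNIV)" unfolding c_def by measurable
  note part = measurable_partition_fibres[OF this]
  have "measure M V = 0 \<or> (\<forall>x\<in>V. \<forall>y\<in>V. (1 + \<bar>h x\<bar>) * norm (f x - f y) \<le> e)"
    if "V \<in> range (\<lambda>v. c -` {v} \<inter> space M) - {{}}" for V
  proof -
    from that obtain v where "V = c -` {v} \<inter> space M" by blast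
    then obtain b k i where V: "V = c -` {(b, k, i)} \<inter> space M" by (cases v) blast
    show ?thesis
    proof (cases b)
      case True
      then have "V \<subseteq> E" unfolding V c_def by auto
      moreover have "V \<in> sets M" using part that by (auto simp: measurable_partition_def)
      ultimately have "V \<in> null_sets M" using E null_sets_subset by blast
      then have "measure M V = 0" by (auto simp: measure_def)
      then show ?thesis by blast
    next
      case False
      have near: "\<bar>h x\<bar> \<le> real k + 1 \<and> norm (f x - d i) < r k" if "x \<in> V" for x
      proof -
        have x: "x \<in> space M - E" "level x = k" "near x = i" using that False unfolding V c_def by auto
        have "\<exists>j. indicator (space M - E) x * norm (f x - d j) < r (level x)"
          using d x(1) r by simp
        then have "indicator (space M - E) x * norm (f x - d (near x)) < r (level x)"
          unfolding near_def by (rule LeastI_ex)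
        moreover have "\<bar>h x\<bar> \<le> real k + 1" using x(2) unfolding level_def by linarith
        ultimately show ?thesis using x by simp
      qed
      have "(1 + \<bar>h x\<bar>) * norm (f x - f y) \<le> e" if "x \<in> V" "y \<in> V" for x y
      proof -
        have "norm (f x - f y) \<le> 2 * r k"
          using near[OF that(1)] near[OF that(2)] norm_triangle_ineq4[of "f x - d i" "f y - d i"] by simp
        then have "(1 + \<bar>h x\<bar>) * norm (f x - f y) \<le> (real k + 2) * (2 * r k)"
          using near[OF that(1)] by (intro mult_mono) auto
        also have "\<dots> = e" by (simp add: r_def field_simps)
        finally show ?thesis .
      qed
      then show ?thesis by blast
    qed
  qed
  then show ?thesis by (intro that[OF part] ballI)
qed

section \<open>Comparing the two Birkhoff integrals\<close>

text \<open>The errors on the single cells add up to at most \<open>e * measure M A\<close> for every partial sum, so no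
  convergence of the sums of errors has to be discussed.\<close>

lemma (in finite_measure) birkhoff_limit_transfer:
  fixes S T :: "'a \<Rightarrow> 'a set \<Rightarrow> 'b::banach"
  assumes S: "birkhoff_limit M A S J"
    and close: "\<And>e. e > 0 \<Longrightarrow> \<exists>P. measurable_partition M A P \<and>
      (\<forall>V\<in>P. \<forall>W\<in>sets M. \<forall>\<omega>\<in>W. W \<subseteq> V \<longrightarrow> norm (S \<omega> W - T \<omega> W) \<le> e * measure M W)"
  shows "birkhoff_limit M A T J"
  unfolding birkhoff_limit_iff_eventually
proof (intro allI impI)
  fix e :: real assume "e > 0"
  \<comment> \<open>The summand \<open>1\<close> covers the case that \<open>A\<close> is null.\<close>
  define e' where "e' = e / (2 * (measure M A + 1))"
  have pos: "measure M A + 1 > 0" using measure_nonneg[of M A] by linarith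
  then have "e' > 0" using \<open>e > 0\<close> by (simp add: e'_def)
  have e': "e' * measure M A \<le> e / 2"
    using \<open>e > 0\<close> pos by (simp add: e'_def field_simps)
  obtain P where P: "measurable_partition M A P"
    "\<And>I U \<omega>. tagged_refinement M A P I U \<omega> \<Longrightarrow>
      \<forall>\<^sub>F n in sequentially. norm ((\<Sum>k\<in>I \<inter> {..<n}. S (\<omega> k) (U k)) - J) < e / 2"
    using S half_gt_zero[OF \<open>e > 0\<close>] unfolding birkhoff_limit_iff_eventually by meson
  obtain Q where Q: "measurable_partition M A Q"
    "\<And>V W \<omega>. V \<in> Q \<Longrightarrow> W \<in> sets M \<Longrightarrow> \<omega> \<in> W \<Longrightarrow> W \<subseteq> V \<Longrightarrow>
      norm (S \<omega> W - T \<omega> W) \<le> e' * measure M W"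
    using close[OF \<open>e' > 0\<close>] by blast
  obtain R where R: "measurable_partition M A R" "refines A R P" "refines A R Q"
    using measurable_partition_common_refinement[OF P(1) Q(1)] .
  have "\<forall>\<^sub>F n in sequentially. norm ((\<Sum>k\<in>I \<inter> {..<n}. T (\<omega> k) (U k)) - J) < e"
    if tag: "tagged_refinement M A R I U \<omega>" for I U \<omega>
    using P(2)[OF tagged_refinement_mono[OF tag R(2)]]
  proof eventually_elim
    fix n
    assume n: "norm ((\<Sum>k\<in>I \<inter> {..<n}. S (\<omega> k) (U k)) - J) < e / 2"
    note U = tagged_refinementD[OF tagged_refinement_mono[OF tag R(3)]]
    have "norm ((\<Sum>k\<in>I \<inter> {..<n}. S (\<omega> k) (U k)) - (\<Sum>k\<in>I \<inter> {..<n}. T (\<omega> k) (U k)))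
        \<le> (\<Sum>k\<in>I \<inter> {..<n}. e' * measure M (U k))"
      unfolding sum_subtractf[symmetric]
    proof (rule sum_norm_le)
      fix k assume "k \<in> I \<inter> {..<n}"
      then show "norm (S (\<omega> k) (U k) - T (\<omega> k) (U k)) \<le> e' * measure M (U k)"
        using U(3-5)[of k] Q(2) by blast
    qed
    also have "\<dots> \<le> e' * measure M A"
    proof -
      have tot: "((\<lambda>k. measure M (U k)) has_sum measure M A) I"
        using has_sum_measure_UN[OF U(1,3)] U(2) by simp
      have fin: "((\<lambda>k. measure M (U k)) has_sum (\<Sum>k\<in>I \<inter> {..<n}. measure M (U k))) (I \<inter> {..<n})"
        by (rule has_sum_finite) simp
      have "(\<Sum>k\<in>I \<inter> {..<n}. measure M (U k)) \<le> measure M A"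
        by (rule has_sum_mono2[OF fin tot]) auto
      then show ?thesis
        using \<open>e' > 0\<close> by (simp add: sum_distrib_left[symmetric])
    qed
    finally have "norm ((\<Sum>k\<in>I \<inter> {..<n}. S (\<omega> k) (U k)) - (\<Sum>k\<in>I \<inter> {..<n}. T (\<omega> k) (U k)))
        \<le> e' * measure M A" .
    then show "norm ((\<Sum>k\<in>I \<inter> {..<n}. T (\<omega> k) (U k)) - J) < e"
      using n e' norm_triangle_ineq4[of "(\<Sum>k\<in>I \<inter> {..<n}. S (\<omega> k) (U k)) - J"
          "(\<Sum>k\<in>I \<inter> {..<n}. S (\<omega> k) (U k)) - (\<Sum>k\<in>I \<inter> {..<n}. T (\<omega> k) (U k))"]
      by simp
  qed
  with R(1) show "\<exists>P. measurable_partition M A P \<and>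
       (\<forall>I U \<omega>. tagged_refinement M A P I U \<omega> \<longrightarrow>
          (\<forall>\<^sub>F n in sequentially. norm ((\<Sum>k\<in>I \<inter> {..<n}. T (\<omega> k) (U k)) - J) < e))"
    by blast
qed

text \<open>A finite oscillation bound makes \<open>f\<close> bounded on \<open>A\<close>; strong measurability supplies the fine
  partitions of the whole space, which are then cut down to \<open>A\<close>.\<close>

lemma (in finite_measure) bi1_integrable_of_small_oscillation:
  fixes f :: "'a \<Rightarrow> 'b::banach"
  assumes f: "strongly_measurable M f" and A: "A \<in> sets M"
    and osc: "\<And>x y. x \<in> A \<Longrightarrow> y \<in> A \<Longrightarrow> norm (f x - f y) \<le> d"
  shows "bi1_integrable M A f"
proof -
  obtain B where B: "\<And>x. x \<in> A \<Longrightarrow> norm (f x) \<le> B"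
  proof (cases "A = {}")
    case False
    then obtain y where "y \<in> A" by blast
    have "norm (f x) \<le> norm (f y) + d" if "x \<in> A" for x
      using osc[OF that \<open>y \<in> A\<close>] norm_triangle_sub[of "f x" "f y"] by linarith
    then show ?thesis by (rule that)
  qed (use that in auto)
  show ?thesis
  proof (rule bi1_integrable_of_fine_partitions[OF B])
    fix e :: real assume "e > 0"
    obtain P where P: "measurable_partition M (space M) P"
      and "\<forall>V\<in>P. measure M V = 0 \<or> (\<forall>x\<in>V. \<forall>y\<in>V. (1 + \<bar>0::real\<bar>) * norm (f x - f y) \<le> e)"
      by (rule strongly_measurable_fine_partition[OF f _ \<open>e > 0\<close>, of "\<lambda>_. 0"]) auto
    then have "oscillation_le M f e V" if "V \<in> P" for V
      using that by (simp add: oscillation_le_def)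
    then have "\<forall>V\<in>(\<inter>) A ` P - {{}}. oscillation_le M f e V"
      using P oscillation_le_subset[of f e _ "A \<inter> _"] by (auto simp: measurable_partition_def)
    with measurable_partition_restrict[OF P A sets.sets_into_space[OF A]]
    show "\<exists>P. measurable_partition M A P \<and> (\<forall>V\<in>P. oscillation_le M f e V)" by blast
  qed
qed

theorem theorem2p7:
  fixes M :: "'a measure"
    and \<phi> :: "'a \<Rightarrow> real"
    and \<Phi> :: "'a \<Rightarrow> 'b::banach"
    and N :: "'a set \<Rightarrow> 'b"
  assumes "finite_measure M"
    and "\<phi> \<in> borel_measurable M"
    and "strongly_measurable M \<Phi>"
    and "bi1_integrable M (space M) \<Phi>"
    and "\<And>A. A \<in> sets M \<Longrightarrow> N A = bi1_integral M A \<Phi>"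
  shows "(bi1_integrable M (space M) (\<lambda>\<omega>. \<phi> \<omega> *\<^sub>R \<Phi> \<omega>) \<longleftrightarrow> bi2_integrable M (space M) N \<phi>)
    \<and> (bi1_integrable M (space M) (\<lambda>\<omega>. \<phi> \<omega> *\<^sub>R \<Phi> \<omega>) \<longrightarrow>
         bi1_integral M (space M) (\<lambda>\<omega>. \<phi> \<omega> *\<^sub>R \<Phi> \<omega>) = bi2_integral M (space M) N \<phi>)"
proof -
  interpret finite_measure M by fact
  let ?S = "\<lambda>\<omega> U. measure M U *\<^sub>R (\<phi> \<omega> *\<^sub>R \<Phi> \<omega>)" and ?T = "\<lambda>\<omega> U. \<phi> \<omega> *\<^sub>R N U"
  have close: "\<exists>P. measurable_partition M (space M) P \<and>
      (\<forall>V\<in>P. \<forall>W\<in>sets M. \<forall>\<omega>\<in>W. W \<subseteq> V \<longrightarrow> norm (?S \<omega> W - ?T \<omega> W) \<le> e * measure M W)"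
    if "e > 0" for e
  proof -
    obtain P where P: "measurable_partition M (space M) P"
      and osc: "\<forall>V\<in>P. measure M V = 0 \<or> (\<forall>x\<in>V. \<forall>y\<in>V. (1 + \<bar>\<phi> x\<bar>) * norm (\<Phi> x - \<Phi> y) \<le> e)"
      using strongly_measurable_fine_partition[OF assms(3,2) \<open>e > 0\<close>] .
    have "norm (?S \<omega> W - ?T \<omega> W) \<le> e * measure M W"
      if V: "V \<in> P" and W: "W \<in> sets M" "\<omega> \<in> W" "W \<subseteq> V" for V W \<omega>
    proof (cases "measure M V = 0")
      case True
      have "V \<in> sets M" using P V by (auto simp: measurable_partition_def)
      then have "measure M W = 0"
        using finite_measure_mono[OF W(3)] True measure_nonneg[of M W] by simp
      moreover from this have "N W = 0"
        using assms(5)[OF W(1)] bi1_integral_eqI[OF has_bi1_integral_null[OF W(1)]] by simp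
      ultimately show ?thesis by simp
    next
      case False
      \<comment> \<open>The oscillation of \<open>\<Phi>\<close> about the tag, small enough to absorb the factor \<open>\<phi> \<omega>\<close>.\<close>
      define d where "d = e / (1 + \<bar>\<phi> \<omega>\<bar>)"
      have near: "(1 + \<bar>\<phi> x\<bar>) * norm (\<Phi> x - \<Phi> y) \<le> e" if "x \<in> W" "y \<in> W" for x y
        using osc V False W(3) that by blast
      have nd: "norm (\<Phi> x - \<Phi> \<omega>) \<le> d" if "x \<in> W" for x
        using near[OF W(2) that] by (simp add: d_def norm_minus_commute field_simps)
      have "norm (\<Phi> x - \<Phi> y) \<le> d + d" if "x \<in> W" "y \<in> W" for x y
        using nd[OF that(1)] nd[OF that(2)] by norm
      then have "bi1_integrable M W \<Phi>"
        by (rule bi1_integrable_of_small_oscillation[OF assms(3) W(1)])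
      then have "has_bi1_integral M W \<Phi> (N W)"
        using assms(5)[OF W(1)] bi1_integral_eqI by (metis bi1_integrable_def)
      then have "norm (measure M W *\<^sub>R \<Phi> \<omega> - N W) \<le> d * measure M W"
        using nd by (rule bi1_integral_mean_value)
      then have "\<bar>\<phi> \<omega>\<bar> * norm (measure M W *\<^sub>R \<Phi> \<omega> - N W) \<le> (1 + \<bar>\<phi> \<omega>\<bar>) * (d * measure M W)"
        by (intro mult_mono) auto
      also have "\<dots> = e * measure M W" by (simp add: d_def)
      also have "\<bar>\<phi> \<omega>\<bar> * norm (measure M W *\<^sub>R \<Phi> \<omega> - N W) = norm (?S \<omega> W - ?T \<omega> W)"
        unfolding norm_scaleR[symmetric] by (simp add: scaleR_diff_right mult.commute)
      finally show ?thesis .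
    qed
    with P show ?thesis by blast
  qed
  have "birkhoff_limit M (space M) ?S J \<longleftrightarrow> birkhoff_limit M (space M) ?T J" for J
  proof
    assume "birkhoff_limit M (space M) ?S J"
    then show "birkhoff_limit M (space M) ?T J" by (rule birkhoff_limit_transfer) (rule close)
  next
    assume "birkhoff_limit M (space M) ?T J"
    then show "birkhoff_limit M (space M) ?S J"
      by (rule birkhoff_limit_transfer) (subst norm_minus_commute, rule close)
  qed
  then have "has_bi1_integral M (space M) (\<lambda>\<omega>. \<phi> \<omega> *\<^sub>R \<Phi> \<omega>) = has_bi2_integral M (space M) N \<phi>"
    by (intro ext) (simp only: has_bi1_integral_def has_bi2_integral_def)
  then show ?thesis
    by (simp add: bi1_integrable_def bi2_integrable_def bi1_integral_def bi2_integral_def)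
qed

end
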